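(* Let $D\subseteq\mathbb{R}$, let $F_2:D\to I_2(\mathbb{R})$ be a Type-2 interval-valued function, $F_2(x)=[(\underline{f}_L(x),\overline{f}_L(x)),(\underline{f}_U(x),\overline{f}_U(x))]$, and let $x_o$ be a limit point of $D$. Then $\lim_{x\to x_o}F_2(x)$ exists if and only if $\lim_{x\to x_o}\underline{f}_L(x)$, $\lim_{x\to x_o}\overline{f}_L(x)$, $\lim_{x\to x_o}\underline{f}_U(x)$ and $\lim_{x\to x_o}\overline{f}_U(x)$ all exist, and in that case $$\lim_{x\to x_o}F_2(x)=\Big[\Big(\lim_{x\to x_o}\underline{f}_L(x),\lim_{x\to x_o}\overline{f}_L(x)\Big),\Big(\lim_{x\to x_o}\underline{f}_U(x),\lim_{x\to x_o}\overline{f}_U(x)\Big)\Big].$$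
   Context: A Type-2 interval is given by four real numbers $\underline{a}_L\le\overline{a}_L\le\underline{a}_U\le\overline{a}_U$ and is written $A=[(\underline{a}_L,\overline{a}_L),(\underline{a}_U,\overline{a}_U)]$; $I_2(\mathbb{R})$ denotes the set of all Type-2 intervals, with equality meaning equality of the four corresponding entries. The extended Moore distance is $$D_{M_2}(X,Y)=\max\{|\underline{x}_L-\underline{y}_L|,\ |\overline{x}_L-\overline{y}_L|,\ |\underline{x}_U-\underline{y}_U|,\ |\overline{x}_U-\overline{y}_U|\}.$$ A Type-2 interval-valued function $F_2:D\to I_2(\mathbb{R})$ is written $F_2(x)=[(\underline{f}_L(x),\overline{f}_L(x)),(\underline{f}_U(x),\overline{f}_U(x))]$ with real functions $\underline{f}_L\le\overline{f}_L\le\underline{f}_U\le\overline{f}_U$ on $D$. For a limit point $x_o$ of $D$ and $L\in I_2(\mathbb{R})$, $\lim_{x\to x_o}F_2(x)=L$ means: for every $\varepsilon>0$ there is $\delta>0$ such that $D_{M_2}(F_2(x),L)<\varepsilon$ for all $x\in D$ with $0<|x-x_o|<\delta$. Limits of real functions are finite limits. *)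

theory Defs
  imports "HOL-Analysis.Analysis"
begin

text \<open>The interval [(a, b), (c, d)] is represented by the nested pair ((a, b), (c, d)), so that
  equality is equality of the four entries; the ordering of the entries is imposed by the
  carrier set.\<close>

type_synonym quad = "(real \<times> real) \<times> (real \<times> real)"

definition I2 :: "quad set" where
  "I2 = {((a, b), (c, d)) | a b c d. a \<le> b \<and> b \<le> c \<and> c \<le> d}"

fun D_M2 :: "quad \<Rightarrow> quad \<Rightarrow> real" where
  "D_M2 ((a, b), (c, d)) ((a', b'), (c', d')) = Max {\<bar>a - a'\<bar>, \<bar>b - b'\<bar>, \<bar>c - c'\<bar>, \<bar>d - d'\<bar>}"

text \<open>A function on D is a total function of which only the values on D matter.\<close>

definition has_lim2 :: "real set \<Rightarrow> (real \<Rightarrow> quad) \<Rightarrow> real \<Rightarrow> quad \<Rightarrow> bool" where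
  "has_lim2 D F x\<^sub>o L \<longleftrightarrow> L \<in> I2 \<and>
     (\<forall>\<epsilon>>0. \<exists>\<delta>>0. \<forall>x\<in>D. 0 < \<bar>x - x\<^sub>o\<bar> \<and> \<bar>x - x\<^sub>o\<bar> < \<delta> \<longrightarrow> D_M2 (F x) L < \<epsilon>)"

definition lim2 :: "real set \<Rightarrow> (real \<Rightarrow> quad) \<Rightarrow> real \<Rightarrow> quad" where
  "lim2 D F x\<^sub>o = (THE L. has_lim2 D F x\<^sub>o L)"

text \<open>At a limit point of D the limit is unique, so the description operator in
  \<^const>\<open>lim2\<close> picks out the limit whenever there is one.\<close>

lemma D_M2_less_iff:
  "D_M2 ((a, b), (c, d)) ((a', b'), (c', d')) < e \<longleftrightarrow>
     \<bar>a - a'\<bar> < e \<and> \<bar>b - b'\<bar> < e \<and> \<bar>c - c'\<bar> < e \<and> \<bar>d - d'\<bar> < e"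
  by simp

lemma D_M2_triangle_less:
  assumes "D_M2 X Y < e" "D_M2 X Z < e'"
  shows "D_M2 Y Z < e + e'"
proof -
  obtain a b c d where X: "X = ((a, b), (c, d))" by (metis surj_pair)
  obtain a' b' c' d' where Y: "Y = ((a', b'), (c', d'))" by (metis surj_pair)
  obtain a'' b'' c'' d'' where Z: "Z = ((a'', b''), (c'', d''))" by (metis surj_pair)
  have tri: "\<bar>v - w\<bar> < e + e'" if "\<bar>u - v\<bar> < e" "\<bar>u - w\<bar> < e'" for u v w
    using that by linarith
  show ?thesis
    using assms unfolding X Y Z D_M2_less_iff by (blast intro: tri)
qed

lemma D_M2_eqI:
  assumes "\<And>e. e > 0 \<Longrightarrow> D_M2 Y Z < e"
  shows "Y = Z"
proof -
  obtain a b c d where Y: "Y = ((a, b), (c, d))" by (metis surj_pair)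
  obtain a' b' c' d' where Z: "Z = ((a', b'), (c', d'))" by (metis surj_pair)
  have eq: "u = v" if "\<And>e. e > 0 \<Longrightarrow> \<bar>u - v\<bar> < e" for u v :: real
    using that[of "\<bar>u - v\<bar>"] by force
  show ?thesis
    using assms unfolding Y Z D_M2_less_iff by (auto intro: eq)
qed

lemma has_lim2_unique:
  assumes "x\<^sub>o islimpt D" and L: "has_lim2 D F x\<^sub>o L" and M: "has_lim2 D F x\<^sub>o M"
  shows "L = M"
proof (rule D_M2_eqI)
  fix e :: real assume "e > 0"
  then have "e / 2 > 0" by simp
  obtain d1 where d1: "d1 > 0"
    "\<And>x. x \<in> D \<Longrightarrow> 0 < \<bar>x - x\<^sub>o\<bar> \<Longrightarrow> \<bar>x - x\<^sub>o\<bar> < d1 \<Longrightarrow> D_M2 (F x) L < e / 2"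
    using L \<open>e / 2 > 0\<close> unfolding has_lim2_def by blast
  obtain d2 where d2: "d2 > 0"
    "\<And>x. x \<in> D \<Longrightarrow> 0 < \<bar>x - x\<^sub>o\<bar> \<Longrightarrow> \<bar>x - x\<^sub>o\<bar> < d2 \<Longrightarrow> D_M2 (F x) M < e / 2"
    using M \<open>e / 2 > 0\<close> unfolding has_lim2_def by blast
  obtain x where x: "x \<in> D" "x \<noteq> x\<^sub>o" "dist x x\<^sub>o < min d1 d2"
    using assms(1) d1(1) d2(1) unfolding islimpt_approachable by (metis min_less_iff_conj)
  then have "D_M2 (F x) L < e / 2" "D_M2 (F x) M < e / 2"
    using d1(2)[of x] d2(2)[of x] by (auto simp: dist_real_def)
  then show "D_M2 L M < e"
    using D_M2_triangle_less[of "F x" L "e / 2" M "e / 2"] by simp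
qed

lemma lim2_eqI:
  assumes "x\<^sub>o islimpt D" "has_lim2 D F x\<^sub>o L"
  shows "lim2 D F x\<^sub>o = L"
  unfolding lim2_def using assms has_lim2_unique by blast

end

theory Submission
  imports Defs
begin

text \<open>Since the distance is a maximum of four coordinate distances, convergence in it is
  coordinatewise convergence. The one point needing an argument is that the coordinatewise limits
  are again ordered, hence form a Type-2 interval: weak inequalities pass to the limit because
  the base point is a limit point of the domain.\<close>

text \<open>The punctured \<delta>-neighbourhoods are those of \<open>at\<close>, so limits of
  Type-2 intervals become accessible to filter reasoning.\<close>

lemma has_lim2_iff_eventually:
  "has_lim2 D F x\<^sub>o L \<longleftrightarrow>
     L \<in> I2 \<and> (\<forall>\<epsilon>>0. eventually (\<lambda>x. D_M2 (F x) L < \<epsilon>) (at x\<^sub>o within D))"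
  unfolding has_lim2_def eventually_at by (simp add: dist_real_def)

text \<open>A maximum of four distances is below \<epsilon> iff each one is, and
  \<open>eventually\<close> distributes over finite conjunctions. Membership in \<open>I2\<close>
  stays on the right: at a point that is not a limit point of \<open>D\<close>, convergence does not
  force any ordering.\<close>

lemma has_lim2_iff_tendsto:
  assumes "\<And>x. x \<in> D \<Longrightarrow> F x = ((p x, q x), (r x, s x))"
  shows "has_lim2 D F x\<^sub>o ((a, b), (c, d)) \<longleftrightarrow> ((a, b), (c, d)) \<in> I2 \<and>
     (p \<longlongrightarrow> a) (at x\<^sub>o within D) \<and> (q \<longlongrightarrow> b) (at x\<^sub>o within D) \<and>
     (r \<longlongrightarrow> c) (at x\<^sub>o within D) \<and> (s \<longlongrightarrow> d) (at x\<^sub>o within D)"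
proof -
  have "eventually (\<lambda>x. D_M2 (F x) ((a, b), (c, d)) < \<epsilon>) (at x\<^sub>o within D) \<longleftrightarrow>
      eventually (\<lambda>x. \<bar>p x - a\<bar> < \<epsilon> \<and> \<bar>q x - b\<bar> < \<epsilon> \<and> \<bar>r x - c\<bar> < \<epsilon> \<and> \<bar>s x - d\<bar> < \<epsilon>)
        (at x\<^sub>o within D)" for \<epsilon>
    \<comment> \<open>The formula for \<open>F\<close> is known only on \<open>D\<close>, so it is
      substituted under the quantifier bounded by \<open>D\<close>.\<close>
    unfolding eventually_at using assms by (simp cong: ball_cong)
  then show ?thesis
    unfolding has_lim2_iff_eventually tendsto_iff dist_real_def
    by (auto simp: eventually_conj_iff simp del: D_M2.simps)
qed

lemma tendsto_le_within:
  fixes f g :: "real \<Rightarrow> real"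
  assumes "x\<^sub>o islimpt D" "\<And>x. x \<in> D \<Longrightarrow> f x \<le> g x"
    and "(f \<longlongrightarrow> l) (at x\<^sub>o within D)" "(g \<longlongrightarrow> m) (at x\<^sub>o within D)"
  shows "l \<le> m"
proof (rule tendsto_le)
  show "at x\<^sub>o within D \<noteq> bot"
    using assms(1) by (simp add: trivial_limit_within)
  show "eventually (\<lambda>x. f x \<le> g x) (at x\<^sub>o within D)"
    using assms(2) by (auto simp: eventually_at_filter)
qed (use assms in auto)

theorem theorem6p1:
  fixes D :: "real set" and F\<^sub>2 :: "real \<Rightarrow> quad" and x\<^sub>o :: real
    and l_fL u_fL l_fU u_fU :: "real \<Rightarrow> real"
  assumes "F\<^sub>2 \<in> D \<rightarrow> I2"
    and "\<And>x. x \<in> D \<Longrightarrow> F\<^sub>2 x = ((l_fL x, u_fL x), (l_fU x, u_fU x))"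
    and "x\<^sub>o islimpt D"
  shows "((\<exists>L. has_lim2 D F\<^sub>2 x\<^sub>o L) \<longleftrightarrow>
            (\<exists>l. (l_fL \<longlongrightarrow> l) (at x\<^sub>o within D)) \<and>
            (\<exists>l. (u_fL \<longlongrightarrow> l) (at x\<^sub>o within D)) \<and>
            (\<exists>l. (l_fU \<longlongrightarrow> l) (at x\<^sub>o within D)) \<and>
            (\<exists>l. (u_fU \<longlongrightarrow> l) (at x\<^sub>o within D)))
       \<and> ((\<exists>L. has_lim2 D F\<^sub>2 x\<^sub>o L) \<longrightarrow>
            lim2 D F\<^sub>2 x\<^sub>o =
              ((Lim (at x\<^sub>o within D) l_fL, Lim (at x\<^sub>o within D) u_fL),
               (Lim (at x\<^sub>o within D) l_fU, Lim (at x\<^sub>o within D) u_fU)))"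
proof -
  note iff = has_lim2_iff_tendsto[OF assms(2)]
  have nontriv: "at x\<^sub>o within D \<noteq> bot"
    using assms(3) by (simp add: trivial_limit_within)
  \<comment> \<open>Comparing the given entries of the value with those provided by
    \<open>I2\<close> yields the pointwise order.\<close>
  have ordered: "l_fL x \<le> u_fL x" "u_fL x \<le> l_fU x" "l_fU x \<le> u_fU x" if "x \<in> D" for x
    using assms(1,2) that by (force simp: I2_def Pi_iff)+
  have ex: "\<exists>L. has_lim2 D F\<^sub>2 x\<^sub>o L"
    if "(l_fL \<longlongrightarrow> a) (at x\<^sub>o within D)" "(u_fL \<longlongrightarrow> b) (at x\<^sub>o within D)"
      "(l_fU \<longlongrightarrow> c) (at x\<^sub>o within D)" "(u_fU \<longlongrightarrow> d) (at x\<^sub>o within D)" for a b c d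
  proof -
    have "a \<le> b" "b \<le> c" "c \<le> d"
      using tendsto_le_within[OF assms(3)] ordered that by blast+
    then have "has_lim2 D F\<^sub>2 x\<^sub>o ((a, b), (c, d))"
      using that by (simp add: iff I2_def)
    then show ?thesis ..
  qed
  have lims: "(l_fL \<longlongrightarrow> a) (at x\<^sub>o within D) \<and> (u_fL \<longlongrightarrow> b) (at x\<^sub>o within D) \<and>
      (l_fU \<longlongrightarrow> c) (at x\<^sub>o within D) \<and> (u_fU \<longlongrightarrow> d) (at x\<^sub>o within D)"
    if "has_lim2 D F\<^sub>2 x\<^sub>o ((a, b), (c, d))" for a b c d
    using that by (simp add: iff)
  \<comment> \<open>Uniqueness of the limit is used twice: for \<open>lim2\<close>, and for each
    coordinate, where \<open>Lim\<close> returns the limit because the filter is nontrivial.\<close>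
  have val: "lim2 D F\<^sub>2 x\<^sub>o =
      ((Lim (at x\<^sub>o within D) l_fL, Lim (at x\<^sub>o within D) u_fL),
       (Lim (at x\<^sub>o within D) l_fU, Lim (at x\<^sub>o within D) u_fU))"
    if "has_lim2 D F\<^sub>2 x\<^sub>o ((a, b), (c, d))" for a b c d
    using lims[OF that] lim2_eqI[OF assms(3) that] by (auto dest: tendsto_Lim[OF nontriv])
  show ?thesis
    \<comment> \<open>\<open>surj_pair\<close> splits an arbitrary limit into the four entries that
      \<open>lims\<close> and \<open>val\<close> expect.\<close>
    using ex lims val by (metis surj_pair)
qed

end
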